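(* There exist $3$-connected graphs $G$ on $n$ vertices (where $n = |V(G)|$) with exactly $\frac{15}{8} n$ edges such that for every vertex $v \in V(G)$ the induced subgraph $G[N(v)]$ contains a cycle.
   Context: Graphs are finite, simple and undirected; $V(G)$ denotes the vertex set of $G$. For a vertex $v$, $N(v)$ denotes the (open) neighborhood of $v$, i.e. the set of vertices adjacent to $v$, and $G[N(v)]$ denotes the subgraph of $G$ induced by $N(v)$. A graph is $3$-connected if it has more than $3$ vertices and remains connected after deleting any set of at most $2$ vertices. *)

theory Defs
  imports Complex_Main "Graph_Theory.Graph_Theory"
begin

(* A finite simple undirected graph is represented, as in Graph_Theory, by a finite loop-free
   symmetric digraph without parallel arcs. Every undirected edge then corresponds to two
   opposite arcs, which uedges identifies. *)
definition uedges :: "('a, 'b) pre_digraph \<Rightarrow> 'a set set" where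
  "uedges G = (\<lambda>e. {tail G e, head G e}) ` arcs G"

definition nbhd :: "('a, 'b) pre_digraph \<Rightarrow> 'a \<Rightarrow> 'a set" where
  "nbhd G v = {w. v \<rightarrow>\<^bsub>G\<^esub> w}"

(* The length bound is needed: pre_digraph.cycle also accepts the closed walk u, v, u along
   the two arcs of a single undirected edge. *)
definition has_ucycle :: "('a, 'b) pre_digraph \<Rightarrow> bool" where
  "has_ucycle G \<longleftrightarrow> (\<exists>p. pre_digraph.cycle G p \<and> length p \<ge> 3)"

definition k_connected :: "nat \<Rightarrow> ('a, 'b) pre_digraph \<Rightarrow> bool" where
  "k_connected k G \<longleftrightarrow> card (verts G) > k \<and>
    (\<forall>S. S \<subseteq> verts G \<and> card S < k \<longrightarrow> connected (G \<restriction> (verts G - S)))"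

end

theory Submission
  imports Defs
begin

text \<open>
  A vertex whose neighbourhood contains a triangle lies in a \<open>K\<^sub>4\<close>, so it is enough to
  partition the vertex set into copies of \<open>K\<^sub>4\<close>. In each copy one vertex, the centre, receives
  no further edge, and each of the other three receives exactly one edge to another copy. The
  degrees in a copy are then \<open>3, 4, 4, 4\<close>, of average \<open>15 / 4\<close>, which gives \<open>15 / 8\<close> edges per
  vertex.

  The smallest such graph has two copies of \<open>K\<^sub>4\<close>, joined by a matching of size three between
  their non-central vertices: \<open>8\<close> vertices and \<open>6 + 6 + 3 = 15\<close> edges. It is
  \<open>3\<close>-connected because two deleted vertices meet at most two of the three disjoint matching
  edges. A surviving one joins the remains of the two copies, and each of these is still
  complete (\<open>matched_K4s_minus_connected\<close>).
\<close>

text \<open>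
  The copies of \<open>K\<^sub>4\<close> are the two classes of \<open>{0..<8}\<close> under division by \<open>4\<close>. The residue
  modulo \<open>4\<close> is the position in the copy, with the centre at position \<open>0\<close>.
\<close>

definition matched_K4s :: "nat pair_pre_digraph" where
  "matched_K4s = \<lparr> pverts = {0..<8},
     parcs = {(u, v). u < 8 \<and> v < 8 \<and> u \<noteq> v \<and>
       (u div 4 = v div 4 \<or> u mod 4 = v mod 4 \<and> u mod 4 \<noteq> 0)} \<rparr>"

lemma pverts_matched_K4s [simp]: "pverts matched_K4s = {0..<8}"
  by (simp add: matched_K4s_def)

lemma parcs_matched_K4s: "(u, v) \<in> parcs matched_K4s \<longleftrightarrow>
    u < 8 \<and> v < 8 \<and> u \<noteq> v \<and> (u div 4 = v div 4 \<or> u mod 4 = v mod 4 \<and> u mod 4 \<noteq> 0)"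
  by (simp add: matched_K4s_def)

lemma pair_graph_matched_K4s: "pair_graph matched_K4s"
proof
  show "finite (parcs matched_K4s)"
    by (rule finite_subset[of _ "{0..<8} \<times> {0..<8}"]) (auto simp: parcs_matched_K4s)
  show "symmetric (with_proj matched_K4s)"
    by (auto simp: symmetric_def sym_def parcs_matched_K4s)
qed (auto simp: parcs_matched_K4s)

lemma dominates_induce_with_proj:
  "u \<rightarrow>\<^bsub>with_proj G \<restriction> S\<^esub> v \<longleftrightarrow> (u, v) \<in> parcs G \<and> u \<in> S \<and> v \<in> S"
  by (auto simp: arcs_ends_conv induce_subgraph_def)

lemma has_ucycle_triangle:
  assumes "distinct [a, b, c]" and "{a, b, c} \<subseteq> S"
    and "(a, b) \<in> parcs G" "(b, c) \<in> parcs G" "(c, a) \<in> parcs G"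
  shows "has_ucycle (with_proj G \<restriction> S)"
  unfolding has_ucycle_def
proof (intro exI conjI)
  show "pre_digraph.cycle (with_proj G \<restriction> S) [(a, b), (b, c), (c, a)]"
    unfolding pre_digraph.cycle_def pre_digraph.awalk_def
    by (rule exI[of _ a])
      (use assms in \<open>auto simp: pre_digraph.cas.simps pre_digraph.awalk_verts.simps\<close>)
qed simp

text \<open>The cycle is the triangle on the other three vertices of the copy that contains \<open>v\<close>.\<close>

lemma matched_K4s_nbhd_cycle:
  assumes "v < 8"
  shows "has_ucycle (with_proj matched_K4s \<restriction> nbhd (with_proj matched_K4s) v)"
proof -
  let ?K = "{4 * (v div 4)..<4 * (v div 4) + 4}"
  have "card (?K - {v}) = 3"
    by (subst card_Diff_singleton) auto
  then obtain a b c where K: "?K - {v} = {a, b, c}" and ne: "a \<noteq> b" "a \<noteq> c" "b \<noteq> c"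
    unfolding card_3_iff by blast
  have "v div 4 < 2"
    using assms by auto
  then have clique: "x < 8 \<and> x div 4 = v div 4 \<and> x \<noteq> v" if "x \<in> {a, b, c}" for x
    using that unfolding K[symmetric] by auto
  show ?thesis
    by (rule has_ucycle_triangle[of a b c])
      (use ne clique[of a] clique[of b] clique[of c] assms
        in \<open>auto simp: nbhd_def parcs_matched_K4s\<close>)
qed

lemma matched_K4s_minus_connected:
  assumes "finite S" and "card S < 3"
  shows "connected (with_proj matched_K4s \<restriction> ({0..<8} - S))" (is "connected ?H")
proof -
  interpret pair_graph matched_K4s by (rule pair_graph_matched_K4s)
  interpret H: wf_digraph ?H by (rule wellformed_induce_subgraph)
  \<comment> \<open>The matching edges correspond to the residues \<open>1, 2, 3\<close>, and \<open>S\<close> has too few elements to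
    meet all three.\<close>
  have "card ((\<lambda>x. x mod 4) ` S) < card {1, 2, 3 :: nat}"
    using card_image_le[OF assms(1), of "\<lambda>x. x mod 4"] assms(2) by simp
  then have "\<not> {1, 2, 3} \<subseteq> (\<lambda>x. x mod 4) ` S"
    using card_mono[OF finite_imageI[OF assms(1)]] by (metis not_le)
  then obtain i where i: "i \<in> {1, 2, 3}" and "i \<notin> (\<lambda>x. x mod 4) ` S"
    by blast
  then have free: "i \<notin> S" "i + 4 \<notin> S"
    by (force simp: image_iff)+
  have adj: "x \<rightarrow>\<^bsub>?H\<^esub> y" if "x \<in> {0..<8} - S" "y \<in> {0..<8} - S" "(x, y) \<in> parcs matched_K4s" for x y
    using that by (simp add: dominates_induce_with_proj)
  have bridge: "(i + 4) \<rightarrow>\<^bsub>?H\<^esub> i"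
    using i free by (intro adj) (auto simp: parcs_matched_K4s)
  \<comment> \<open>Vertices of the first copy are equal or adjacent to \<open>i\<close>, those of the second to
    \<open>i + 4\<close>.\<close>
  have to_i: "u \<rightarrow>\<^sup>*\<^bsub>?H\<^esub> i" if u: "u \<in> {0..<8} - S" for u
  proof (cases "u < 4")
    case True
    show ?thesis
    proof (cases "u = i")
      case False
      have "u \<rightarrow>\<^bsub>?H\<^esub> i"
        using u i free False True by (intro adj) (auto simp: parcs_matched_K4s)
      then show ?thesis by simp
    qed (use u in simp)
  next
    case far: False
    then have "u div 4 = 1" using u by auto
    show ?thesis
    proof (cases "u = i + 4")
      case False
      have "u \<rightarrow>\<^bsub>?H\<^esub> (i + 4)"
        using u i free False \<open>u div 4 = 1\<close> by (intro adj) (auto simp: parcs_matched_K4s)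
      then show ?thesis using bridge by (meson H.adj_reachable_trans H.reachable_adjI)
    qed (use bridge in simp)
  qed
  have "symmetric ?H"
    using sym_arcs by (auto simp: symmetric_def sym_def parcs_matched_K4s dominates_induce_with_proj)
  then have "u \<rightarrow>\<^sup>*\<^bsub>?H\<^esub> v" if "u \<in> verts ?H" "v \<in> verts ?H" for u v
    using H.reachable_trans[OF to_i symmetric_reachable[OF _ to_i]] that
    unfolding induce_subgraph_verts by blast
  moreover have "verts ?H \<noteq> {}"
    using bridge H.adj_in_verts by blast
  ultimately show ?thesis
    by (intro H.connectedI H.reachable_mk_symmetricI)
qed

lemma k_connected_matched_K4s: "k_connected 3 (with_proj matched_K4s)"
  unfolding k_connected_def
  by (auto intro!: matched_K4s_minus_connected intro: finite_subset)

lemma card_uedges_matched_K4s: "card (uedges (with_proj matched_K4s)) = 15"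
proof -
  let ?K = "\<lambda>A :: nat set. {e. e \<subseteq> A \<and> card e = 2}"
  let ?M = "{{1, 5}, {2, 6}, {3, 7 :: nat}}"
  have "uedges (with_proj matched_K4s) = ?K {0..<4} \<union> ?K {4..<8} \<union> ?M" (is "?E = ?R")
  proof
    show "?E \<subseteq> ?R"
    proof
      fix e assume "e \<in> ?E"
      then obtain u v where e: "e = {u, v}" and uv: "(u, v) \<in> parcs matched_K4s"
        by (auto simp: uedges_def)
      show "e \<in> ?R"
      proof (cases "u div 4 = v div 4")
        case True
        then have "u < 4 \<longleftrightarrow> v < 4" by auto
        moreover have "u < 8" "v < 8" "card e = 2"
          using uv by (auto simp: e parcs_matched_K4s)
        ultimately show ?thesis
          by (auto simp: e)
      next
        case False
        then have "u mod 4 = v mod 4" "u mod 4 \<noteq> 0" "u < 8" "v < 8"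
          using uv by (auto simp: parcs_matched_K4s)
        define a b r where "a = u div 4" and "b = v div 4" and "r = u mod 4"
        with \<open>u mod 4 = v mod 4\<close> have "u = 4 * a + r" "v = 4 * b + r"
          by (metis mult_div_mod_eq)+
        moreover have "a < 2" "b < 2" "a \<noteq> b" "r < 4" "r \<noteq> 0"
          using False \<open>u < 8\<close> \<open>v < 8\<close> \<open>u mod 4 \<noteq> 0\<close> by (simp_all add: a_def b_def r_def)
        then have "a = 0 \<and> b = 1 \<or> a = 1 \<and> b = 0" "r \<in> {1, 2, 3}"
          by auto
        ultimately have "e \<in> ?M"
          unfolding e by (elim disjE conjE insertE emptyE) (simp_all add: doubleton_eq_iff)
        then show ?thesis
          by blast
      qed
    qed
  next
    have edge: "{u, v} \<in> ?E" if "(u, v) \<in> parcs matched_K4s" for u v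
      using that by (force simp: uedges_def)
    have "e \<in> ?E" if "e \<in> ?K {0..<4} \<union> ?K {4..<8}" for e
    proof -
      have "card e = 2" using that by auto
      then obtain u v where e: "e = {u, v}" "u \<noteq> v"
        unfolding card_2_iff by blast
      with that have uv: "u < 4 \<and> v < 4 \<or> u \<in> {4..<8} \<and> v \<in> {4..<8}"
        by auto
      have "x div 4 = 1" if "x \<in> {4..<8}" for x :: nat
        using that by auto
      with uv have "u div 4 = v div 4"
        by auto
      then show ?thesis
        using edge[of u v] e uv by (auto simp: parcs_matched_K4s)
    qed
    moreover have "e \<in> ?E" if "e \<in> ?M" for e
      using that edge[of 1 5] edge[of 2 6] edge[of 3 7] by (auto simp: parcs_matched_K4s)
    ultimately show "?R \<subseteq> ?E"
      by blast
  qed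
  moreover have "card (?K {0..<4}) = 6" "card (?K {4..<8}) = 6"
    using n_subsets[of "{0..<4::nat}" 2] n_subsets[of "{4..<8::nat}" 2] by (simp_all add: choose_two)
  moreover have "?K {0..<4} \<inter> ?K {4..<8} = {}"
  proof (rule equals0I)
    fix e assume "e \<in> ?K {0..<4} \<inter> ?K {4..<8}"
    then have "e \<subseteq> {0..<4}" "e \<subseteq> {4..<8}" "card e = 2"
      by blast+
    moreover from this have "e = {}"
      by force
    ultimately show False
      by simp
  qed
  moreover have "(?K {0..<4} \<union> ?K {4..<8}) \<inter> ?M = {}"
    by (simp add: Int_Un_distrib2)
  moreover have "card ?M = 3"
    by (simp add: doubleton_eq_iff)
  moreover have "finite (?K {0..<4})" "finite (?K {4..<8})"
    by simp_all
  ultimately show ?thesis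
    by (simp only: card_Un_disjoint finite_Un finite_insert finite.emptyI)
qed

theorem theorem2:
  shows "\<exists>G :: nat pair_pre_digraph. pair_graph G \<and> k_connected 3 (with_proj G) \<and>
    real (card (uedges (with_proj G))) = 15 / 8 * real (card (pverts G)) \<and>
    (\<forall>v \<in> pverts G. has_ucycle (with_proj G \<restriction> nbhd (with_proj G) v))"
  by (intro exI[of _ matched_K4s])
    (simp add: pair_graph_matched_K4s k_connected_matched_K4s card_uedges_matched_K4s
      matched_K4s_nbhd_cycle)

end
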